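(* There exists $c\in\{-1,1\}$ such that the coefficient of $x^{a_{1m}}$ in the implicit equation $\phi$ is $c(-c_{1m})^{a_{0n}}$ and the coefficient of $y^{a_{0n}}$ is $c(-c_{0n})^{a_{1m}}$.
   Context: Consider a polynomial parameterization $x=P_0(t)$, $y=P_1(t)$ with $P_0,P_1\in\mathbb{C}[t]$ having fixed supports and generic coefficients (the result holds for all coefficient vectors in some open dense subset), the parameterization having degree $1$. Let $f_0=x-P_0(t)$, $f_1=y-P_1(t)\in(\mathbb{C}[x,y])[t]$, with supports (in $t$) $A_0=\{a_{00}<a_{01}<\dots<a_{0n}\}$ and $A_1=\{a_{10}<a_{11}<\dots<a_{1m}\}$, where $a_{00}=a_{10}=0$. The coefficients of $P_i$ are denoted $c_{ij}$; in particular $c_{0n}$ is the coefficient of $t^{a_{0n}}$ in $P_0$ and $c_{1m}$ is the coefficient of $t^{a_{1m}}$ in $P_1$. The implicit equation $\phi\in\mathbb{C}[x,y]$ is, up to sign, the resultant of $f_0,f_1$ with respect to $t$ (obtained by specializing the coefficients in the sparse resultant of the supports $A_0,A_1$).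
   Formalization: The coefficient of x^{a_{1m}} carries an extra factor (-1)^{a_{0n}a_{1m}}; with one common c the printed formula fails when a_{0n} and a_{1m} are both odd (P_0=P_1=t gives ±(x-y)). *)

theory Defs
  imports "HOL-Analysis.Function_Topology" "HOL-Analysis.Product_Topology"
    "Subresultants.Resultant_Prelim"
begin

text \<open>The polynomial with exponents \<open>a 0, \<dots>, a n\<close> and coefficients \<open>c 0, \<dots>, c n\<close>.\<close>

definition sparse_poly :: "nat \<Rightarrow> (nat \<Rightarrow> nat) \<Rightarrow> (nat \<Rightarrow> complex) \<Rightarrow> complex poly" where
  "sparse_poly n a c = (\<Sum>j\<le>n. monom (c j) (a j))"

text \<open>A coefficient vector with \<open>n + 1\<close> entries is a function on \<open>{..n}\<close>, extended by
  \<^const>\<open>undefined\<close>; \<open>coeff_space n\<close> is \<open>n + 1\<close>-dimensional complex space with its usual topology.\<close>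

definition coeff_space :: "nat \<Rightarrow> (nat \<Rightarrow> complex) topology" where
  "coeff_space n = product_topology (\<lambda>_. euclidean) {..n}"

text \<open>The property \<open>Q\<close> holds for generic pairs of coefficient vectors. Having all coefficients
  nonzero is itself an open dense condition, so the supports need not be imposed separately.\<close>

definition holds_generically ::
  "nat \<Rightarrow> nat \<Rightarrow> ((nat \<Rightarrow> complex) \<Rightarrow> (nat \<Rightarrow> complex) \<Rightarrow> bool) \<Rightarrow> bool" where
  "holds_generically n m Q \<longleftrightarrow>
    (\<exists>U. openin (prod_topology (coeff_space n) (coeff_space m)) U \<and>
      prod_topology (coeff_space n) (coeff_space m) closure_of U
        = topspace (prod_topology (coeff_space n) (coeff_space m)) \<and>
      (\<forall>(c0, c1) \<in> U. Q c0 c1))"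

text \<open>The degree of a parameterization is the number of parameter values over a generic point
  of its image.\<close>

definition has_parameterization_degree ::
  "complex poly \<Rightarrow> complex poly \<Rightarrow> nat \<Rightarrow> bool" where
  "has_parameterization_degree P0 P1 d \<longleftrightarrow>
    finite {t. \<not> (finite {s. poly P0 s = poly P0 t \<and> poly P1 s = poly P1 t} \<and>
      card {s. poly P0 s = poly P0 t \<and> poly P1 s = poly P1 t} = d)}"

text \<open>The ring \<open>\<complex>[x,y]\<close> is rendered as \<open>(\<complex>[x])[y]\<close>, of type \<^typ>\<open>complex poly poly\<close>: the inner
  variable is \<open>x\<close>, the outer one is \<open>y\<close>. Polynomials in \<open>t\<close> over it have type
  \<^typ>\<open>complex poly poly poly\<close>.\<close>

definition var_x :: "complex poly poly" where
  "var_x = [:[:0, 1:]:]"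

definition var_y :: "complex poly poly" where
  "var_y = [:0, 1:]"

definition coeff_xy :: "complex poly poly \<Rightarrow> nat \<Rightarrow> nat \<Rightarrow> complex" where
  "coeff_xy \<phi> i j = coeff (coeff \<phi> j) i"

text \<open>\<open>v - P(t)\<close> as a polynomial in \<open>t\<close> over \<open>\<complex>[x,y]\<close>.\<close>

definition minus_param :: "complex poly poly \<Rightarrow> complex poly \<Rightarrow> complex poly poly poly" where
  "minus_param v P = [:v:] - map_poly (\<lambda>c. [:[:c:]:]) P"

text \<open>The implicit equation is normalised as the resultant with respect to \<open>t\<close> of
  \<open>x - P0(t)\<close> and \<open>y - P1(t)\<close>, which leaves a choice of sign.
  With leading coefficients \<open>p\<close> of \<open>P0\<close> and \<open>q\<close> of \<open>P1\<close>, the product formula for the resultant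
  gives the extreme terms \<open>(-p) ^ deg P1\<close> at \<open>y ^ deg P0\<close> and
  \<open>(-1) ^ (deg P0 * deg P1) * (-q) ^ deg P0\<close> at \<open>x ^ deg P1\<close>. The relative sign cannot be
  dropped: for \<open>P0 = P1 = t\<close> the resultant is \<open>x - y\<close>.\<close>

definition implicit_equation :: "complex poly \<Rightarrow> complex poly \<Rightarrow> complex poly poly \<Rightarrow> bool" where
  "implicit_equation P0 P1 \<phi> \<longleftrightarrow>
    \<phi> = resultant (minus_param var_x P0) (minus_param var_y P1) \<or>
    \<phi> = - resultant (minus_param var_x P0) (minus_param var_y P1)"

end

theory Submission
  imports Defs "Subresultants.Subresultant"
begin

text \<open>Consider the Sylvester determinant of \<open>f = x - P0(t)\<close> and \<open>g = y - P1(t)\<close>, of degrees \<open>N\<close>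
  and \<open>M\<close> in \<open>t\<close>. The variable \<open>y\<close> occurs only in the constant term of \<open>g\<close>, hence exactly
  once in each of the \<open>N\<close> rows made of shifts of \<open>g\<close>, and there it stands on the diagonal.
  The coefficient of \<open>y ^ N\<close> in the determinant is therefore the determinant of the matrix in which
  each of these rows is replaced by its \<open>y\<close>-coefficients, that is by a unit vector
  (\<open>coeff_det_row_degrees\<close>). The new matrix is upper triangular with the leading coefficient of
  \<open>f\<close> in its first \<open>M\<close> diagonal places, so the coefficient is a power of that leading coefficient
  (\<open>coeff_resultant_linear_constant_term\<close>). That power is then evaluated
  at \<open>x = 0\<close>, which matters when \<open>N = 0\<close> and the leading coefficient of \<open>f\<close> is itself
  \<open>x - P0(0)\<close>.

  For the coefficient of \<open>x ^ M\<close>, first set \<open>y = 0\<close>, which does not affect degrees in \<open>t\<close>, and then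
  exchange the two arguments of the resultant. The exchange produces the sign
  \<open>(-1) ^ (N * M)\<close>, and the roles of the two polynomials are reversed.

  Genericity supplies that the top coefficients of \<open>P0\<close> and \<open>P1\<close> do not vanish, an open dense
  condition, so that \<open>N\<close> and \<open>M\<close> are the largest exponents of the supports.\<close>

section \<open>Top coefficients of determinants over a polynomial ring\<close>

lemma coeff_prod_degree_bounds:
  fixes f :: "'i \<Rightarrow> 'a :: comm_ring_1 poly"
  assumes "finite I" and "\<And>i. i \<in> I \<Longrightarrow> degree (f i) \<le> d i"
  shows "degree (\<Prod>i\<in>I. f i) \<le> (\<Sum>i\<in>I. d i) \<and>
    coeff (\<Prod>i\<in>I. f i) (\<Sum>i\<in>I. d i) = (\<Prod>i\<in>I. coeff (f i) (d i))"
  using assms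
proof (induction I rule: finite_induct)
  case (insert j I)
  let ?P = "\<Prod>i\<in>I. f i" and ?D = "\<Sum>i\<in>I. d i"
  have IH: "degree ?P \<le> ?D" "coeff ?P ?D = (\<Prod>i\<in>I. coeff (f i) (d i))"
    and fj: "degree (f j) \<le> d j"
    using insert by auto
  have "degree (f j * ?P) \<le> d j + ?D"
    using degree_mult_le[of "f j" ?P] IH(1) fj by linarith
  moreover have "coeff (f j * ?P) (d j + ?D) = coeff (f j) (d j) * coeff ?P ?D"
  proof -
    have "coeff (f j) i * coeff ?P (d j + ?D - i) = 0" if "i \<le> d j + ?D" "i \<noteq> d j" for i
    proof (cases "i < d j")
      case True
      then have "coeff ?P (d j + ?D - i) = 0"
        using IH(1) by (intro coeff_eq_0) linarith
      then show ?thesis by simp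
    next
      case False
      then have "coeff (f j) i = 0"
        using fj that by (intro coeff_eq_0) linarith
      then show ?thesis by simp
    qed
    then have "(\<Sum>i\<le>d j + ?D. coeff (f j) i * coeff ?P (d j + ?D - i))
        = (\<Sum>i\<in>{d j}. coeff (f j) i * coeff ?P (d j + ?D - i))"
      by (intro sum.mono_neutral_right) auto
    then show ?thesis by (simp add: coeff_mult)
  qed
  ultimately show ?case
    using insert.hyps IH(2) by simp
qed simp

text \<open>Each term of the Leibniz expansion takes one entry from every row, so the row bounds add up
  and the top coefficient is multiplicative in every term.\<close>

lemma coeff_det_row_degrees:
  fixes A :: "'a :: comm_ring_1 poly mat"
  assumes A: "A \<in> carrier_mat n n"
    and deg: "\<And>i j. i < n \<Longrightarrow> j < n \<Longrightarrow> degree (A $$ (i, j)) \<le> d i"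
  shows "coeff (det A) (\<Sum>i<n. d i) = det (mat n n (\<lambda>(i, j). coeff (A $$ (i, j)) (d i)))"
proof -
  have "coeff (signof p * (\<Prod>i = 0..<n. A $$ (i, p i))) (\<Sum>i<n. d i)
      = signof p * (\<Prod>i = 0..<n. coeff (A $$ (i, p i)) (d i))" if "p permutes {0..<n}" for p
  proof -
    have p: "p i < n" if "i < n" for i
      using permutes_in_image[OF \<open>p permutes {0..<n}\<close>, of i] that by simp
    have "coeff (\<Prod>i = 0..<n. A $$ (i, p i)) (\<Sum>i = 0..<n. d i)
        = (\<Prod>i = 0..<n. coeff (A $$ (i, p i)) (d i))"
      using coeff_prod_degree_bounds[of "{0..<n}" "\<lambda>i. A $$ (i, p i)" d] deg p by simp
    then show ?thesis
      by (simp add: sign_def lessThan_atLeast0)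
  qed
  moreover have "det (mat n n (\<lambda>(i, j). coeff (A $$ (i, j)) (d i)))
      = (\<Sum>p | p permutes {0..<n}. signof p * (\<Prod>i = 0..<n. coeff (A $$ (i, p i)) (d i)))"
  proof -
    have "(\<Prod>i = 0..<n. mat n n (\<lambda>(i, j). coeff (A $$ (i, j)) (d i)) $$ (i, p i))
        = (\<Prod>i = 0..<n. coeff (A $$ (i, p i)) (d i))" if "p permutes {0..<n}" for p
      using permutes_in_image[OF that] by (intro prod.cong) auto
    then show ?thesis
      by (subst det_def'[of _ n]) (auto intro!: sum.cong)
  qed
  ultimately show ?thesis
    by (simp add: det_def'[OF A] coeff_sum)
qed

section \<open>Resultants in which one constant term carries the variable\<close>

text \<open>Here \<open>'a poly poly\<close> is read as polynomials in \<open>t\<close> over a ring \<open>R[y]\<close>. The hypotheses say that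
  \<open>y\<close> occurs only in the constant term of \<open>g\<close>, and there linearly, so the row bounds for the
  Sylvester matrix are \<open>0\<close> for the rows of \<open>f\<close> and \<open>1\<close> for those of \<open>g\<close>.\<close>

lemma coeff_resultant_linear_constant_term:
  fixes f g :: "'a :: comm_ring_1 poly poly"
  assumes f: "\<And>k. degree (coeff f k) = 0"
    and g: "\<And>k. k > 0 \<Longrightarrow> degree (coeff g k) = 0"
    and g0: "degree (coeff g 0) \<le> 1"
  shows "coeff (resultant f g) (degree f)
    = coeff (lead_coeff f) 0 ^ degree g * coeff (coeff g 0) 1 ^ degree f"
proof -
  define N M where "N = degree f" and "M = degree g"
  define d :: "nat \<Rightarrow> nat" where "d i = (if i < M then 0 else 1)" for i
  let ?S = "sylvester_mat f g"
  define B where "B = mat (N + M) (N + M) (\<lambda>(i, j). coeff (?S $$ (i, j)) (d i))"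
  have S: "?S \<in> carrier_mat (N + M) (N + M)"
    by (auto simp: N_def M_def)
  have entry: "?S $$ (i, j) =
      (if i < M then if i \<le> j \<and> j - i \<le> N then coeff f (N + i - j) else 0
       else if i - M \<le> j \<and> j \<le> i then coeff g (i - j) else 0)"
    if "i < N + M" "j < N + M" for i j
    using sylvester_index_mat[of i f g j] that by (simp add: N_def M_def)
  have g_le: "degree (coeff g k) \<le> 1" for k
    using g[of k] g0 by (cases k) auto
  have "degree (?S $$ (i, j)) \<le> d i" if "i < N + M" "j < N + M" for i j
    using f g_le by (simp add: entry[OF that] d_def)
  from coeff_det_row_degrees[OF S this]
  have "coeff (resultant f g) (\<Sum>i<N + M. d i) = det B"
    by (simp add: resultant_def B_def)
  moreover have "(\<Sum>i<N + M. d i) = N"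
  proof -
    have "(\<Sum>i<N + M. d i) = card ({..<N + M} \<inter> - {i. i < M})"
      by (simp add: d_def sum.If_cases)
    also have "{..<N + M} \<inter> - {i. i < M} = {M..<N + M}" by auto
    finally show ?thesis by simp
  qed
  moreover have "det B = coeff (lead_coeff f) 0 ^ M * coeff (coeff g 0) 1 ^ N"
  proof -
    have "upper_triangular B"
    proof (rule upper_triangularI)
      fix i j assume "j < i" "i < dim_row B"
      moreover from this have "coeff (coeff g (i - j)) 1 = 0"
        using g[of "i - j"] by (intro coeff_eq_0) simp
      ultimately show "B $$ (i, j) = 0"
        by (simp add: B_def entry d_def)
    qed
    then have "det B = (\<Prod>i = 0..<N + M. B $$ (i, i))"
      by (subst det_upper_triangular[of _ "N + M"]) (auto simp: B_def prod_list_diag_prod)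
    also have "\<dots> = (\<Prod>i = 0..<N + M. if i < M then coeff (lead_coeff f) 0 else coeff (coeff g 0) 1)"
      by (intro prod.cong) (auto simp: B_def entry d_def N_def)
    also have "\<dots> = coeff (lead_coeff f) 0 ^ card ({0..<N + M} \<inter> {i. i < M})
        * coeff (coeff g 0) 1 ^ card ({0..<N + M} \<inter> - {i. i < M})"
      by (simp add: prod.If_cases)
    also have "{0..<N + M} \<inter> {i. i < M} = {0..<M}" by auto
    also have "{0..<N + M} \<inter> - {i. i < M} = {M..<N + M}" by auto
    finally show ?thesis by simp
  qed
  ultimately show ?thesis by (simp add: N_def M_def)
qed

section \<open>Extreme coefficients of the implicit equation\<close>

lemma coeff_minus_param:
  "coeff (minus_param v P) k = (if k = 0 then v else 0) - [:[:coeff P k:]:]"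
  by (cases k) (simp_all add: minus_param_def coeff_map_poly)

lemma degree_minus_param [simp]: "degree (minus_param v P) = degree P"
proof (rule antisym)
  show "degree (minus_param v P) \<le> degree P"
    by (rule degree_le) (simp add: coeff_minus_param coeff_eq_0)
  show "degree P \<le> degree (minus_param v P)"
  proof (cases "degree P = 0")
    case False
    then have "coeff P (degree P) \<noteq> 0" by auto
    with False show ?thesis by (intro le_degree) (simp add: coeff_minus_param)
  qed simp
qed

lemma coeff_y_resultant_minus_param:
  "coeff_xy (resultant (minus_param var_x P0) (minus_param var_y P1)) 0 (degree P0)
    = (- lead_coeff P0) ^ degree P1"
proof -
  have "coeff (resultant (minus_param var_x P0) (minus_param var_y P1)) (degree P0)
      = coeff (lead_coeff (minus_param var_x P0)) 0 ^ degree P1"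
    by (subst coeff_resultant_linear_constant_term
        [of "minus_param var_x P0" "minus_param var_y P1", simplified])
       (auto simp: coeff_minus_param var_x_def var_y_def)
  then show ?thesis
    by (simp add: coeff_xy_def coeff_0_power coeff_minus_param var_x_def)
qed

text \<open>The lemma on linear constant terms applies to \<open>y - P1\<close> as a polynomial over
  \<open>(\<complex>[x])[y]\<close>, but not to \<open>x - P0\<close>, since \<open>x\<close> is the inner variable. Setting \<open>y = 0\<close>
  leaves polynomials over \<open>\<complex>[x]\<close> alone.\<close>

lemma coeff_x_resultant_minus_param:
  "coeff_xy (resultant (minus_param var_x P0) (minus_param var_y P1)) (degree P1) 0
    = (-1) ^ (degree P0 * degree P1) * (- lead_coeff P1) ^ degree P0"
proof -
  define h where "h = (\<lambda>p :: complex poly poly. coeff p 0)"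
  interpret h: comm_ring_hom h
    by unfold_locales (auto simp: h_def coeff_mult_0)
  have coeff_h: "coeff (map_poly h (minus_param v P)) k
      = (if k = 0 then coeff v 0 else 0) - [:coeff P k:]" for v P k
    by (simp add: coeff_map_poly coeff_minus_param h_def)
  have degree_h: "degree (map_poly h (minus_param v P)) = degree P" for v P
  proof (rule antisym)
    show "degree (map_poly h (minus_param v P)) \<le> degree P"
      using degree_map_poly_le[of h "minus_param v P"] by simp
    show "degree P \<le> degree (map_poly h (minus_param v P))"
    proof (cases "degree P = 0")
      case False
      then have "coeff P (degree P) \<noteq> 0" by auto
      with False have "coeff (map_poly h (minus_param v P)) (degree P) \<noteq> 0"
        unfolding coeff_h by simp
      then show ?thesis by (rule le_degree)
    qed simp
  qed
  let ?F = "map_poly h (minus_param var_x P0)" and ?G = "map_poly h (minus_param var_y P1)"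
  have "coeff (resultant (minus_param var_x P0) (minus_param var_y P1)) 0 = resultant ?F ?G"
    using h.resultant_map_poly[of "minus_param var_x P0" "minus_param var_y P1"]
    by (simp add: degree_h) (simp add: h_def)
  also have "\<dots> = (-1) ^ (degree P0 * degree P1) * resultant ?G ?F"
    by (subst resultant_swap) (simp add: degree_h)
  also have "coeff \<dots> (degree P1)
      = (-1) ^ (degree P0 * degree P1) * coeff (resultant ?G ?F) (degree P1)"
    by (cases "even (degree P0 * degree P1)") simp_all
  also have "coeff (resultant ?G ?F) (degree P1) = (- lead_coeff P1) ^ degree P0"
    using coeff_resultant_linear_constant_term[of ?G ?F]
    unfolding degree_h coeff_h by (simp add: var_x_def var_y_def)
  finally show ?thesis by (simp add: coeff_xy_def)
qed

lemma extreme_coeffs_implicit_equation: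
  assumes "implicit_equation P0 P1 \<phi>"
  shows "\<exists>c \<in> {-1, 1 :: complex}.
    coeff_xy \<phi> (degree P1) 0
      = c * (-1) ^ (degree P0 * degree P1) * (- lead_coeff P1) ^ degree P0 \<and>
    coeff_xy \<phi> 0 (degree P0) = c * (- lead_coeff P0) ^ degree P1"
proof -
  let ?R = "resultant (minus_param var_x P0) (minus_param var_y P1)"
  have "coeff_xy (- ?R) i j = - coeff_xy ?R i j" for i j
    by (simp add: coeff_xy_def)
  then show ?thesis
    using assms coeff_x_resultant_minus_param[of P0 P1] coeff_y_resultant_minus_param[of P0 P1]
    by (auto simp: implicit_equation_def)
qed

section \<open>Generic coefficients\<close>

lemma coeff_sparse_poly_top:
  assumes "strict_mono_on {..n} a"
  shows "coeff (sparse_poly n a c) (a n) = c n"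
proof -
  have "coeff (sparse_poly n a c) (a n) = (\<Sum>j\<le>n. if j = n then c j else 0)"
    unfolding sparse_poly_def coeff_sum
    using strict_mono_on_eqD[OF assms] by (intro sum.cong) auto
  then show ?thesis by simp
qed

lemma degree_sparse_poly:
  assumes a: "strict_mono_on {..n} a" and c: "c n \<noteq> 0"
  shows "degree (sparse_poly n a c) = a n"
proof (rule antisym)
  have "degree (monom (c j) (a j)) \<le> a n" if "j \<le> n" for j
    using degree_monom_le[of "c j" "a j"] strict_mono_on_leD[OF a, of j n] that by simp
  then show "degree (sparse_poly n a c) \<le> a n"
    unfolding sparse_poly_def by (intro degree_sum_le) auto
  show "a n \<le> degree (sparse_poly n a c)"
    using c by (intro le_degree) (simp add: coeff_sparse_poly_top[OF a])
qed

lemma nonzero_top_coeff_open_dense: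
  defines "V \<equiv> \<lambda>k. {c \<in> topspace (coeff_space k). c k \<noteq> 0}"
  shows "openin (coeff_space k) (V k)"
    and "coeff_space k closure_of V k = topspace (coeff_space k)"
proof -
  define X where "X i = (if i = k then - {0 :: complex} else UNIV)" for i
  have X: "(\<forall>i\<in>{..k}. c i \<in> X i) \<longleftrightarrow> c k \<noteq> 0" for c
    by (auto simp: X_def)
  have V: "V k = PiE {..k} X"
    unfolding set_eq_iff PiE_iff X
    by (auto simp: V_def coeff_space_def extensional_def)
  have "finite {i. X i \<noteq> UNIV}"
    by (rule finite_subset[of _ "{k}"]) (auto simp: X_def)
  then show "openin (coeff_space k) (V k)"
    unfolding V coeff_space_def
    by (intro product_topology_basis) (auto simp: X_def)
  have "closure (X i) = UNIV" for i
    by (simp add: X_def closure_complement)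
  then show "coeff_space k closure_of V k = topspace (coeff_space k)"
    by (simp add: V coeff_space_def closure_of_product_topology)
qed

lemma holds_generically_if_top_coeffs_nonzero:
  assumes "\<And>c0 c1. c0 n \<noteq> 0 \<Longrightarrow> c1 m \<noteq> 0 \<Longrightarrow> Q c0 c1"
  shows "holds_generically n m Q"
proof -
  let ?V = "\<lambda>k. {c \<in> topspace (coeff_space k). c k \<noteq> 0}"
  show ?thesis
    unfolding holds_generically_def using assms
    by (intro exI[of _ "?V n \<times> ?V m"])
       (auto simp: openin_prod_Times_iff closure_of_Times nonzero_top_coeff_open_dense)
qed

theorem corollary21:
  fixes n m :: nat and a0 a1 :: "nat \<Rightarrow> nat"
  assumes "strict_mono_on {..n} a0" and "a0 0 = 0"
    and "strict_mono_on {..m} a1" and "a1 0 = 0"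
  shows "holds_generically n m (\<lambda>c0 c1.
    has_parameterization_degree (sparse_poly n a0 c0) (sparse_poly m a1 c1) 1 \<longrightarrow>
    (\<forall>\<phi>. implicit_equation (sparse_poly n a0 c0) (sparse_poly m a1 c1) \<phi> \<longrightarrow>
      (\<exists>c \<in> {-1, 1 :: complex}.
        coeff_xy \<phi> (a1 m) 0 = c * (-1) ^ (a0 n * a1 m) * (- c1 m) ^ a0 n \<and>
        coeff_xy \<phi> 0 (a0 n) = c * (- c0 n) ^ a1 m)))"
proof (rule holds_generically_if_top_coeffs_nonzero, intro impI allI)
  fix c0 c1 \<phi>
  assume nz: "c0 n \<noteq> 0" "c1 m \<noteq> 0"
    and \<phi>: "implicit_equation (sparse_poly n a0 c0) (sparse_poly m a1 c1) \<phi>"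
  show "\<exists>c \<in> {-1, 1 :: complex}.
      coeff_xy \<phi> (a1 m) 0 = c * (-1) ^ (a0 n * a1 m) * (- c1 m) ^ a0 n \<and>
      coeff_xy \<phi> 0 (a0 n) = c * (- c0 n) ^ a1 m"
    using extreme_coeffs_implicit_equation[OF \<phi>] nz
    by (simp add: degree_sparse_poly[OF assms(1)] degree_sparse_poly[OF assms(3)]
        coeff_sparse_poly_top[OF assms(1)] coeff_sparse_poly_top[OF assms(3)])
qed

end
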